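(* Let $L$ be a real $n$-dimensional vector space, let $S\subset L$ be a finitely generated subsemigroup of the additive group of $L$, and let $\succ$ be the order on $S$ induced by the lexicographic order $\succ_{\mathbf{x}}$ related to some coordinate system $\mathbf{x}$ on $L$. Then $S$ is a well-ordered set with respect to $\succ$ if and only if $2a\succ a$ for every nonzero element $a\in S$.
   Context: A subsemigroup is a subset closed under addition (it need not contain $0$); it is finitely generated if it consists of all finite nonempty sums of elements of some finite subset. A coordinate system $\mathbf{x}=(x_1,\dots,x_n)$ on an $n$-dimensional real vector space $L$ is the ordered tuple of coordinate functions associated with an ordered basis of $L$. The lexicographic order $\succ_{\mathbf{x}}$ related to $\mathbf{x}$ is the strict total order: for distinct $a,b\in L$, $a\succ_{\mathbf{x}} b$ if and only if $x_i(a)>x_i(b)$, where $i$ is the smallest index with $x_i(a)\neq x_i(b)$. The order induced on a subset is the restriction. An ordered set is well-ordered if every nonempty subset has a smallest element, where $x$ is smaller than $y$ when $y\succ x$. *)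

theory Defs
  imports Complex_Main
begin

definition subsemigroup :: "'a::real_vector set \<Rightarrow> bool" where
  "subsemigroup S \<longleftrightarrow> (\<forall>a\<in>S. \<forall>b\<in>S. a + b \<in> S)"

text \<open>The generated semigroup consists of the sums over nonempty lists, so the neutral element is
  not included for free.\<close>

definition finitely_generated :: "'a::real_vector set \<Rightarrow> bool" where
  "finitely_generated S \<longleftrightarrow>
     (\<exists>F\<subseteq>S. finite F \<and> S = {sum_list as |as. as \<noteq> [] \<and> set as \<subseteq> F})"

definition ordered_basis :: "'a::real_vector list \<Rightarrow> bool" where
  "ordered_basis bs \<longleftrightarrow> distinct bs \<and> independent (set bs) \<and> span (set bs) = UNIV"

text \<open>For a basis \<open>B\<close>, \<open>representation B v b\<close> is the coefficient of \<open>b\<close> in the expansion of \<open>v\<close>.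
  Indices start at 0, so \<open>xs ! i\<close> is the coordinate function usually written with index \<open>i + 1\<close>.\<close>

definition coordinate_system :: "('a::real_vector \<Rightarrow> real) list \<Rightarrow> bool" where
  "coordinate_system xs \<longleftrightarrow>
     (\<exists>bs. ordered_basis bs \<and> xs = map (\<lambda>b v. representation (set bs) v b) bs)"

definition lex_greater :: "('a \<Rightarrow> real) list \<Rightarrow> 'a \<Rightarrow> 'a \<Rightarrow> bool" where
  "lex_greater xs a b \<longleftrightarrow>
     (\<exists>i<length xs. (\<forall>j<i. (xs ! j) a = (xs ! j) b) \<and> (xs ! i) a > (xs ! i) b)"

text \<open>The reflexive relation on \<open>S\<close>, smaller element first, as the library's order predicates
  expect it.\<close>

definition induced_lex_order :: "('a \<Rightarrow> real) list \<Rightarrow> 'a set \<Rightarrow> 'a rel" where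
  "induced_lex_order xs S = relation_of (\<lambda>a b. a = b \<or> lex_greater xs b a) S"

lemma coordinate_system_length:
  fixes xs :: "('a::real_vector \<Rightarrow> real) list"
  assumes "coordinate_system xs"
  shows "length xs = dim (UNIV :: 'a set)"
proof -
  obtain bs where bs: "ordered_basis bs" and xs: "xs = map (\<lambda>b v. representation (set bs) v b) bs"
    using assms unfolding coordinate_system_def by blast
  have "dim (UNIV :: 'a set) = card (set bs)"
    using bs(1) dim_eq_card[of "set bs" UNIV] unfolding ordered_basis_def by (simp add: span_UNIV)
  thus ?thesis
    using bs distinct_card[of bs] unfolding ordered_basis_def xs by simp
qed

lemma coordinate_system_eqI:
  assumes "coordinate_system xs" and eq: "\<And>i. i < length xs \<Longrightarrow> (xs ! i) a = (xs ! i) b"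
  shows "a = b"
proof -
  obtain bs where bs: "ordered_basis bs" and xs: "xs = map (\<lambda>b v. representation (set bs) v b) bs"
    using assms(1) unfolding coordinate_system_def by blast
  have ind: "independent (set bs)" and sp: "span (set bs) = UNIV"
    using bs unfolding ordered_basis_def by blast+
  have "representation (set bs) a v = representation (set bs) b v" if "v \<in> set bs" for v
  proof -
    obtain i where i: "i < length bs" "v = bs ! i"
      using \<open>v \<in> set bs\<close> unfolding in_set_conv_nth by blast
    show ?thesis
      using eq[of i] i unfolding xs by (simp only: length_map nth_map)
  qed
  hence "(\<Sum>v\<in>set bs. representation (set bs) a v *\<^sub>R v) =
         (\<Sum>v\<in>set bs. representation (set bs) b v *\<^sub>R v)"
    by (intro sum.cong refl) (simp only:)
  moreover have "(\<Sum>v\<in>set bs. representation (set bs) w v *\<^sub>R v) = w" for w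
    by (rule real_vector.sum_representation_eq[OF ind _ finite_set subset_refl]) (simp only: sp UNIV_I)
  ultimately show ?thesis
    by (simp only:)
qed

lemma lex_greater_irrefl: "\<not> lex_greater xs a a"
  unfolding lex_greater_def by auto

lemma lex_greater_trans:
  assumes "lex_greater xs a b" "lex_greater xs b c"
  shows "lex_greater xs a c"
proof -
  obtain i where i: "i < length xs" "\<forall>j<i. (xs ! j) a = (xs ! j) b" "(xs ! i) a > (xs ! i) b"
    using assms(1) unfolding lex_greater_def by auto
  obtain k where k: "k < length xs" "\<forall>j<k. (xs ! j) b = (xs ! j) c" "(xs ! k) b > (xs ! k) c"
    using assms(2) unfolding lex_greater_def by auto
  have "(xs ! min i k) a > (xs ! min i k) c"
  proof (cases i k rule: linorder_cases)
    case less
    thus ?thesis using i(3) k(2)[rule_format, of i] by simp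
  next
    case equal
    thus ?thesis using i(3) k(3) by simp
  next
    case greater
    thus ?thesis using i(2)[rule_format, of k] k(3) by simp
  qed
  moreover have "\<forall>j<min i k. (xs ! j) a = (xs ! j) c"
    using i(2) k(2) by simp
  moreover have "min i k < length xs"
    using i(1) by simp
  ultimately show ?thesis
    unfolding lex_greater_def by blast
qed

lemma lex_greater_total:
  assumes "coordinate_system xs" "a \<noteq> b"
  shows "lex_greater xs a b \<or> lex_greater xs b a"
proof -
  define P where "P i \<longleftrightarrow> i < length xs \<and> (xs ! i) a \<noteq> (xs ! i) b" for i
  have "\<exists>i. P i"
    using coordinate_system_eqI[OF assms(1), of a b] assms(2) unfolding P_def by metis
  then obtain i where i: "P i" "\<forall>j<i. \<not> P j"
    using exists_least_iff[of P] by metis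
  have eq: "\<forall>j<i. (xs ! j) a = (xs ! j) b"
    using i unfolding P_def by (meson order_less_trans)
  have "(xs ! i) a > (xs ! i) b \<or> (xs ! i) b > (xs ! i) a"
    using i(1) unfolding P_def by linarith
  moreover have "i < length xs"
    using i(1) unfolding P_def by blast
  ultimately show ?thesis
    unfolding lex_greater_def using eq by auto
qed

lemma well_order_on_induced_lex_order_iff:
  assumes "coordinate_system xs"
  shows "well_order_on S (induced_lex_order xs S) \<longleftrightarrow>
    (\<forall>T\<subseteq>S. T \<noteq> {} \<longrightarrow> (\<exists>m\<in>T. \<forall>y\<in>T. y \<noteq> m \<longrightarrow> lex_greater xs y m))"
proof -
  have rel: "(x, y) \<in> induced_lex_order xs S \<longleftrightarrow> x \<in> S \<and> y \<in> S \<and> (x = y \<or> lex_greater xs y x)"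
    for x y
    unfolding induced_lex_order_def relation_of_def by auto
  have lin: "linear_order_on S (induced_lex_order xs S)"
    unfolding linear_order_on_def partial_order_on_def preorder_on_def
  proof (intro conjI)
    show "induced_lex_order xs S \<subseteq> S \<times> S"
      by (simp add: subset_iff rel split_paired_all)
    show "refl_on S (induced_lex_order xs S)"
      by (simp add: refl_on_def rel)
    show "trans (induced_lex_order xs S)"
      unfolding trans_def rel using lex_greater_trans by metis
    show "antisym (induced_lex_order xs S)"
      unfolding antisym_def rel using lex_greater_trans lex_greater_irrefl by metis
    show "total_on S (induced_lex_order xs S)"
      unfolding total_on_def rel using lex_greater_total[OF assms] by metis
  qed
  have mem: "(y, x) \<in> induced_lex_order xs S - Id \<longleftrightarrow> y \<in> S \<and> x \<in> S \<and> lex_greater xs x y" for x y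
    by (auto simp: rel lex_greater_irrefl)
  have "wf (induced_lex_order xs S - Id) \<longleftrightarrow>
    (\<forall>T\<subseteq>S. T \<noteq> {} \<longrightarrow> (\<exists>m\<in>T. \<forall>y\<in>T. y \<noteq> m \<longrightarrow> lex_greater xs y m))" (is "?L \<longleftrightarrow> ?R")
  proof
    assume wf: ?L
    show ?R
    proof (intro allI impI)
      fix T assume T: "T \<subseteq> S" "T \<noteq> {}"
      obtain m where m: "m \<in> T" "\<And>y. (y, m) \<in> induced_lex_order xs S - Id \<Longrightarrow> y \<notin> T"
        using wfE_min'[OF wf T(2)] by metis
      have "lex_greater xs y m" if "y \<in> T" "y \<noteq> m" for y
        using lex_greater_total[OF assms that(2)] m(2)[of y] m(1) that(1) T(1) unfolding mem by blast
      thus "\<exists>m\<in>T. \<forall>y\<in>T. y \<noteq> m \<longrightarrow> lex_greater xs y m"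
        using m(1) by blast
    qed
  next
    assume R: ?R
    show ?L
    proof (rule wfI_min)
      fix x :: 'a and Q assume x: "x \<in> Q"
      show "\<exists>z\<in>Q. \<forall>y. (y, z) \<in> induced_lex_order xs S - Id \<longrightarrow> y \<notin> Q"
      proof (cases "Q \<inter> S = {}")
        case True
        thus ?thesis using x unfolding mem by blast
      next
        case False
        then obtain m where m: "m \<in> Q \<inter> S" "\<forall>y\<in>Q \<inter> S. y \<noteq> m \<longrightarrow> lex_greater xs y m"
          using R by (metis inf_le2)
        have "y \<notin> Q" if "(y, m) \<in> induced_lex_order xs S - Id" for y
          using that m lex_greater_trans lex_greater_irrefl unfolding mem by (metis IntI)
        thus ?thesis using m(1) by blast
      qed
    qed
  qed
  thus ?thesis
    unfolding well_order_on_def using lin by blast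
qed

end

theory Submission
  imports Defs
begin

text \<open>The condition \<open>2a \<succ> a\<close> says that \<open>a\<close> is positive. A negative \<open>a\<close> yields the descending
  chain \<open>a \<succ> 2a \<succ> 3a \<succ> \<dots>\<close>. Conversely, the semigroup generated by nonnegative
  \<open>f\<^sub>1, \<dots>, f\<^sub>r\<close> lies in \<open>\<nat>f\<^sub>1 + \<dots> + \<nat>f\<^sub>r\<close>, and a sum of well-ordered subsets is well-ordered.\<close>

text \<open>\<open>split\<close> replaces compatibility of a total order with addition: it is the
  contrapositive of adding two weak inequalities.\<close>

lemma wfp_on_plus:
  fixes lt :: "'a::plus \<Rightarrow> 'a \<Rightarrow> bool"
  assumes A: "wfp_on A lt" and B: "wfp_on B lt"
    and trans: "\<And>x y z. lt x y \<Longrightarrow> lt y z \<Longrightarrow> lt x z"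
    and split: "\<And>a a' b b'. lt (a' + b') (a + b) \<Longrightarrow> lt a' a \<or> lt b' b"
  shows "wfp_on {a + b |a b. a \<in> A \<and> b \<in> B} lt"
  unfolding wfp_on_iff_ex_minimal
proof (intro allI impI)
  fix T assume T: "T \<subseteq> {a + b |a b. a \<in> A \<and> b \<in> B}" and ne: "T \<noteq> {}"
  define least where "least a U \<longleftrightarrow> (\<forall>a'\<in>A. \<forall>b'\<in>B. a' + b' \<in> U \<longrightarrow> \<not> lt a' a)" for a U
  have ex_least: "\<exists>a\<in>A. \<exists>b\<in>B. a + b \<in> U \<and> least a U" if "U \<subseteq> T" "U \<noteq> {}" for U
  proof -
    let ?P = "{a \<in> A. \<exists>b\<in>B. a + b \<in> U}"
    have "?P \<noteq> {}" using that T by blast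
    then obtain a where "a \<in> ?P" "\<forall>y. lt y a \<longrightarrow> y \<notin> ?P"
      using A[unfolded wfp_on_iff_ex_minimal, rule_format, of ?P] by auto
    then show ?thesis unfolding least_def by blast
  qed
  \<comment> \<open>Along the \<open>t = a + b\<close> for which \<open>a\<close> is a least first summand at or below \<open>t\<close>, descending
    in \<open>t\<close> cannot decrease \<open>a\<close>, so it decreases \<open>b\<close>.\<close>
  define below where "below t = {s \<in> T. s = t \<or> lt s t}" for t
  define Q where "Q = {b \<in> B. \<exists>a\<in>A. a + b \<in> T \<and> least a (below (a + b))}"
  have "Q \<noteq> {}"
    using ex_least[OF subset_refl ne] unfolding Q_def least_def below_def by blast
  then obtain b where b: "b \<in> Q" "\<And>b'. lt b' b \<Longrightarrow> b' \<notin> Q"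
    using B[unfolded wfp_on_iff_ex_minimal, rule_format, of Q] unfolding Q_def by auto
  then obtain a where a: "a \<in> A" "a + b \<in> T" "least a (below (a + b))"
    unfolding Q_def by blast
  \<comment> \<open>A least first summand \<open>a'\<close> among the elements of \<open>T\<close>
    below \<open>a + b\<close> stays least at or below \<open>a' + b'\<close> by transitivity, so
    \<open>b'\<close> lies in \<open>Q\<close>. Then neither summand has decreased, against
    \<open>split\<close>.\<close>
  have "s \<notin> T" if "lt s (a + b)" for s
  proof
    assume "s \<in> T"
    then have "{s \<in> T. lt s (a + b)} \<noteq> {}" using that by blast
    then obtain a' b' where *: "a' \<in> A" "b' \<in> B" "a' + b' \<in> T" "lt (a' + b') (a + b)"
        "least a' {s \<in> T. lt s (a + b)}"
      using ex_least[of "{s \<in> T. lt s (a + b)}"] by blast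
    have "\<not> lt a' a" using a(3) * unfolding least_def below_def by blast
    moreover have "least a' (below (a' + b'))"
      using *(4,5) trans unfolding least_def below_def mem_Collect_eq by metis
    then have "b' \<in> Q" using * unfolding Q_def by blast
    then have "\<not> lt b' b" using b(2) by blast
    ultimately show False using split[OF *(4)] by blast
  qed
  then show "\<exists>z\<in>T. \<forall>y. lt y z \<longrightarrow> y \<notin> T" using a(2) by blast
qed

text \<open>Collecting the copies of one generator lets an induction on the generating set meet a
  sumset; \<open>k = 0\<close> and an empty \<open>cs\<close> are allowed.\<close>

lemma sum_list_insert_decompose:
  fixes f :: "'a::real_vector"
  assumes "set as \<subseteq> insert f F"
  shows "\<exists>k cs. set cs \<subseteq> F \<and> sum_list as = real k *\<^sub>R f + sum_list cs"
  using assms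
proof (induction as)
  case Nil
  show ?case by (rule exI[of _ 0], rule exI[of _ "[]"]) simp
next
  case (Cons a as)
  then obtain k cs where *: "set cs \<subseteq> F" "sum_list as = real k *\<^sub>R f + sum_list cs" by auto
  show ?case
  proof (cases "a = f")
    case True
    then show ?thesis using *
      by (intro exI[of _ "Suc k"] exI[of _ cs]) (simp add: algebra_simps)
  next
    case False
    then show ?thesis using * Cons.prems
      by (intro exI[of _ k] exI[of _ "a # cs"]) (simp add: algebra_simps)
  qed
qed

text \<open>The induction starts from {0}, the value of the empty list. Each new generator keeps the
  set inside a sumset covered by \<open>wfp_on_plus\<close>.\<close>

lemma wfp_on_sum_lists:
  fixes lt :: "'a::real_vector \<Rightarrow> 'a \<Rightarrow> bool"
  assumes "finite F"
    and irrefl: "\<And>x. \<not> lt x x"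
    and trans: "\<And>x y z. lt x y \<Longrightarrow> lt y z \<Longrightarrow> lt x z"
    and split: "\<And>a a' b b'. lt (a' + b') (a + b) \<Longrightarrow> lt a' a \<or> lt b' b"
    and mult: "\<And>f. f \<in> F \<Longrightarrow> wfp_on (range (\<lambda>k. real k *\<^sub>R f)) lt"
  shows "wfp_on {sum_list as |as. set as \<subseteq> F} lt"
  using assms(1) mult
proof (induction F)
  case empty
  then show ?case unfolding wfp_on_iff_ex_minimal
    using irrefl by simp (metis all_not_in_conv singletonD subsetD)
next
  case (insert f F)
  have "wfp_on {a + b |a b. a \<in> range (\<lambda>k. real k *\<^sub>R f) \<and> b \<in> {sum_list as |as. set as \<subseteq> F}} lt"
    using insert.prems insert.IH by (intro wfp_on_plus[OF _ _ trans split]) simp_all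
  then show ?case
    by (rule wfp_on_subset) (use sum_list_insert_decompose[of _ f F] in fastforce)
qed

lemma coordinate_system_linear:
  assumes "coordinate_system xs" "i < length xs"
  shows "linear (xs ! i)"
proof -
  obtain bs where "ordered_basis bs" and xs: "xs = map (\<lambda>b v. representation (set bs) v b) bs"
    using assms(1) unfolding coordinate_system_def by blast
  then have "independent (set bs)" "span (set bs) = UNIV"
    unfolding ordered_basis_def by blast+
  then show ?thesis using assms(2)
    by (intro linearI)
      (simp_all add: xs real_vector.representation_add real_vector.representation_scale)
qed

text \<open>The coordinates are linear, so the order is translation invariant and comparisons reduce
  to signs.\<close>

lemma lex_greater_iff_diff:
  assumes "coordinate_system xs"
  shows "lex_greater xs a b \<longleftrightarrow> lex_greater xs (a - b) 0"
proof -
  have "(xs ! i) (a - b) = (xs ! i) a - (xs ! i) b" "(xs ! i) 0 = 0" if "i < length xs" for i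
    using coordinate_system_linear[OF assms that] by (simp_all add: linear_diff linear_0)
  then show ?thesis unfolding lex_greater_def by (intro ex_cong1) auto
qed

lemma lex_greater_scaleR:
  assumes "coordinate_system xs" "c > 0"
  shows "lex_greater xs (c *\<^sub>R a) 0 \<longleftrightarrow> lex_greater xs a 0"
proof -
  have "(xs ! i) (c *\<^sub>R a) = c * (xs ! i) a" "(xs ! i) 0 = 0" if "i < length xs" for i
    using coordinate_system_linear[OF assms(1) that] by (simp_all add: linear_scale linear_0)
  then show ?thesis using assms(2) unfolding lex_greater_def
    by (intro ex_cong1) (auto simp: zero_less_mult_iff)
qed

text \<open>Otherwise totality gives a \<le> a' and b \<le> b', and translation yields a + b \<le>
  a' + b \<le> a' + b', against \<open>gt\<close>.\<close>

lemma lex_greater_add_split: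
  assumes xs: "coordinate_system xs" and gt: "lex_greater xs (a + b) (a' + b')"
  shows "lex_greater xs a a' \<or> lex_greater xs b b'"
proof (rule ccontr)
  assume "\<not> ?thesis"
  then have le: "a = a' \<or> lex_greater xs a' a" "b = b' \<or> lex_greater xs b' b"
    using lex_greater_total[OF xs] by blast+
  have "a + b = a' + b \<or> lex_greater xs (a' + b) (a + b)"
    using le(1) lex_greater_iff_diff[OF xs, of a' a]
      lex_greater_iff_diff[OF xs, of "a' + b" "a + b"] by auto
  moreover have "a' + b = a' + b' \<or> lex_greater xs (a' + b') (a' + b)"
    using le(2) lex_greater_iff_diff[OF xs, of b' b]
      lex_greater_iff_diff[OF xs, of "a' + b'" "a' + b"] by auto
  ultimately show False
    using gt lex_greater_trans lex_greater_irrefl by metis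
qed

text \<open>If r \<le> s, then (s - r)f is a nonnegative multiple of a nonnegative vector, which
  contradicts \<open>gt\<close>.\<close>

lemma lex_greater_multiples:
  assumes xs: "coordinate_system xs"
    and f: "f = 0 \<or> lex_greater xs f 0"
    and gt: "lex_greater xs (r *\<^sub>R f) (s *\<^sub>R f)"
  shows "s < r"
proof (rule ccontr)
  assume "\<not> s < r"
  moreover have "f \<noteq> 0" "r \<noteq> s" using gt lex_greater_irrefl by force+
  ultimately have "s - r > 0" and pos: "lex_greater xs f 0" using f by auto
  then have "lex_greater xs (s *\<^sub>R f - r *\<^sub>R f) 0"
    using lex_greater_scaleR[OF xs, of "s - r" f] by (simp add: scaleR_left_diff_distrib)
  then have "lex_greater xs (s *\<^sub>R f) (r *\<^sub>R f)"
    using lex_greater_iff_diff[OF xs] by blast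
  from lex_greater_trans[OF gt this] show False by (simp add: lex_greater_irrefl)
qed

lemma wfp_on_multiples:
  assumes "coordinate_system xs" "f = 0 \<or> lex_greater xs f 0"
  shows "wfp_on (range (\<lambda>k. real k *\<^sub>R f)) (\<lambda>x y. lex_greater xs y x)"
  unfolding wfp_on_iff_ex_minimal
proof (intro allI impI)
  fix T assume T: "T \<subseteq> range (\<lambda>k. real k *\<^sub>R f)" "T \<noteq> {}"
  \<comment> \<open>The least multiplier occurring in \<open>T\<close> gives a minimal element,
    since descending in the order lowers the multiplier.\<close>
  then obtain k where k: "real k *\<^sub>R f \<in> T" "\<forall>j<k. real j *\<^sub>R f \<notin> T"
    using exists_least_iff[of "\<lambda>k. real k *\<^sub>R f \<in> T"] by blast
  have "y \<notin> T" if y: "lex_greater xs (real k *\<^sub>R f) y" for y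
  proof
    assume "y \<in> T"
    then obtain j where j: "y = real j *\<^sub>R f" using T(1) by blast
    then have "j < k" using lex_greater_multiples[OF assms] y by fastforce
    then show False using k(2) j \<open>y \<in> T\<close> by blast
  qed
  then show "\<exists>z\<in>T. \<forall>y. lex_greater xs z y \<longrightarrow> y \<notin> T" using k(1) by blast
qed

text \<open>The multiplier is \<open>Suc k\<close> because a subsemigroup need not contain
  0.\<close>

lemma subsemigroup_multiple:
  assumes "subsemigroup S" "a \<in> S"
  shows "real (Suc k) *\<^sub>R a \<in> S"
proof (induction k)
  case (Suc k)
  have "real (Suc (Suc k)) *\<^sub>R a = real (Suc k) *\<^sub>R a + a"
    by (simp add: algebra_simps scaleR_2)
  then show ?case using Suc assms unfolding subsemigroup_def by metis
qed (use assms in simp)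

theorem theorem29:
  fixes S :: "'a::real_vector set" and xs :: "('a \<Rightarrow> real) list" and n :: nat
  assumes "dim (UNIV :: 'a set) = n"
    and "subsemigroup S"
    and "finitely_generated S"
    and "coordinate_system xs"
  shows "well_order_on S (induced_lex_order xs S) \<longleftrightarrow>
    (\<forall>a\<in>S. a \<noteq> 0 \<longrightarrow> lex_greater xs (2 *\<^sub>R a) a)"
proof -
  note xs = assms(4)
  have double: "lex_greater xs (2 *\<^sub>R a) a \<longleftrightarrow> lex_greater xs a 0" for a
    using lex_greater_iff_diff[OF xs, of "2 *\<^sub>R a" a] by (simp add: scaleR_2)
  show ?thesis
    unfolding well_order_on_induced_lex_order_iff[OF xs] double
  proof (intro iffI ballI impI allI)
    fix a
    assume least: "\<forall>T\<subseteq>S. T \<noteq> {} \<longrightarrow> (\<exists>m\<in>T. \<forall>y\<in>T. y \<noteq> m \<longrightarrow> lex_greater xs y m)"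
      and a: "a \<in> S" "a \<noteq> 0"
    \<comment> \<open>The positive multiples of \<open>a\<close> have a least one. The next multiple
      exceeds it by exactly \<open>a\<close>, so \<open>a\<close> is positive.\<close>
    have "range (\<lambda>k. real (Suc k) *\<^sub>R a) \<subseteq> S"
      using subsemigroup_multiple[OF assms(2) a(1)] by blast
    then obtain k where
      k: "\<And>j. real (Suc j) *\<^sub>R a \<noteq> real (Suc k) *\<^sub>R a \<Longrightarrow>
        lex_greater xs (real (Suc j) *\<^sub>R a) (real (Suc k) *\<^sub>R a)"
      using least[rule_format, of "range (\<lambda>k. real (Suc k) *\<^sub>R a)"] by auto
    have "lex_greater xs (real (Suc (Suc k)) *\<^sub>R a) (real (Suc k) *\<^sub>R a)"
      using k[of "Suc k"] a(2) by simp
    then show "lex_greater xs a 0"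
      using lex_greater_iff_diff[OF xs, of "real (Suc (Suc k)) *\<^sub>R a" "real (Suc k) *\<^sub>R a"]
      by (simp add: algebra_simps scaleR_2)
  next
    fix T
    assume pos: "\<forall>a\<in>S. a \<noteq> 0 \<longrightarrow> lex_greater xs a 0" and T: "T \<subseteq> S" "T \<noteq> {}"
    obtain F where F: "F \<subseteq> S" "finite F" "S = {sum_list as |as. as \<noteq> [] \<and> set as \<subseteq> F}"
      using assms(3) unfolding finitely_generated_def by blast
    \<comment> \<open>The empty list contributes 0 even when 0 is not in \<open>S\<close>; this is
      harmless, as minimal elements are sought only in subsets of \<open>S\<close>.\<close>
    have "wfp_on {sum_list as |as. set as \<subseteq> F} (\<lambda>x y. lex_greater xs y x)"
    proof (rule wfp_on_sum_lists[OF F(2)])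
      show "wfp_on (range (\<lambda>k. real k *\<^sub>R f)) (\<lambda>x y. lex_greater xs y x)" if "f \<in> F" for f
        using wfp_on_multiples[OF xs] pos F(1) that by blast
    qed (fact lex_greater_irrefl lex_greater_trans lex_greater_add_split[OF xs]
        | erule (1) lex_greater_trans)+
    moreover have "T \<subseteq> {sum_list as |as. set as \<subseteq> F}" using T(1) F(3) by blast
    ultimately obtain m where "m \<in> T" "\<forall>y. lex_greater xs m y \<longrightarrow> y \<notin> T"
      unfolding wfp_on_iff_ex_minimal using T(2) by meson
    \<comment> \<open>Totality turns the minimal element into a least one.\<close>
    then show "\<exists>m\<in>T. \<forall>y\<in>T. y \<noteq> m \<longrightarrow> lex_greater xs y m"
      using lex_greater_total[OF xs] by blast
  qed
qed

end
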